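(* Let $\alpha\ge 3$, $\beta>0$, $t_0>0$, let $\Phi:\mathcal H\to\mathbb R$ be a twice continuously differentiable convex function with $\operatorname{argmin}\Phi\neq\emptyset$, and let $x:[t_0,+\infty[\to\mathcal H$ be a solution of $$\ddot x(t)+\frac{\alpha}{t}\dot x(t)+\beta\nabla^2\Phi(x(t))\dot x(t)+\nabla\Phi(x(t))=0 .$$ Then $x$ is bounded. Moreover, let $x^*\in\operatorname{argmin}\Phi$, $\lambda\in[2,\alpha-1]$ and $t_1=\max\{t_0,\beta\}$. Then for all $t\ge s>t_1$, $$\Phi(x(t))-\min\Phi\le\frac{1}{t^2}\left(\frac{s}{s-\beta}\right)^{\alpha-2}\mathcal E_\lambda(s),$$ where $\mathcal E_\lambda$ is the function (depending on $x^*$) defined in the context. In particular $\Phi(x(t))-\min\Phi=\mathcal O(t^{-2})$ as $t\to+\infty$.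
   Context: $\mathcal H$ is a real Hilbert space with inner product $\langle\cdot,\cdot\rangle$ and norm $\|\cdot\|$. A solution $x$ of the differential equation is a twice continuously differentiable function satisfying it for all $t\ge t_0$. For $\lambda\in[2,\alpha-1]$ and $x^*\in\operatorname{argmin}\Phi$, the function $\mathcal E_\lambda:[t_0,+\infty[\to\mathbb R$ is $$\mathcal E_\lambda(t)=t\big(t-\beta(\lambda+2-\alpha)\big)\big(\Phi(x(t))-\min\Phi\big)+\frac12\big\|\lambda(x(t)-x^* )+t\big(\dot x(t)+\beta\nabla\Phi(x(t))\big)\big\|^2+\lambda(\alpha-\lambda-1)\frac12\|x(t)-x^*\|^2 .$$ *)

theory Defs
  imports "HOL-Analysis.Analysis" "HOL-Library.Landau_Symbols"
begin

(* C^2 on the whole space in the Frechet sense: the derivatives are taken in the spaces of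
   bounded linear maps with the operator norm, and the second one is norm continuous. *)
definition twice_continuously_differentiable ::
    "('a::real_normed_vector \<Rightarrow> 'b::real_normed_vector) \<Rightarrow> bool" where
  "twice_continuously_differentiable f \<longleftrightarrow>
     (\<exists>(D :: 'a \<Rightarrow> 'a \<Rightarrow>\<^sub>L 'b) (D2 :: 'a \<Rightarrow> 'a \<Rightarrow>\<^sub>L ('a \<Rightarrow>\<^sub>L 'b)).
        (\<forall>y. (f has_derivative blinfun_apply (D y)) (at y)) \<and>
        (\<forall>y. (D has_derivative blinfun_apply (D2 y)) (at y)) \<and>
        continuous_on UNIV D2)"

(* The Riesz representative of the derivative; it exists for every differentiable function when
   the space is complete. *)
definition gradient :: "('a::real_inner \<Rightarrow> real) \<Rightarrow> 'a \<Rightarrow> 'a" where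
  "gradient f y = (THE g. GDERIV f y :> g)"

definition hessian :: "('a::real_inner \<Rightarrow> real) \<Rightarrow> 'a \<Rightarrow> 'a \<Rightarrow> 'a" where
  "hessian f y = frechet_derivative (gradient f) (at y)"

lemma gradient_eqI:
  assumes "GDERIV f y :> g"
  shows "gradient f y = g"
  unfolding gradient_def
proof (rule the_equality)
  show "GDERIV f y :> g" by (fact assms)
next
  fix g' assume "GDERIV f y :> g'"
  with assms have "(\<lambda>h. inner h g') = (\<lambda>h. inner h g)"
    unfolding gderiv_def by (metis has_derivative_unique)
  then have "inner (g' - g) (g' - g) = 0"
    by (metis inner_diff_right right_minus_eq)
  then show "g' = g" by simp
qed

lemma hessian_eqI:
  assumes "(gradient f has_derivative H) (at y)"
  shows "hessian f y = H"
  unfolding hessian_def using frechet_derivative_at[OF assms] by simp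

definition argmin :: "('a \<Rightarrow> real) \<Rightarrow> 'a set" where
  "argmin f = {y. is_arg_min f (\<lambda>_. True) y}"

(* Only meaningful if the minimum is attained, i.e. if argmin f is nonempty. *)
definition minval :: "('a \<Rightarrow> real) \<Rightarrow> real" where
  "minval f = (LEAST m. m \<in> range f)"

lemma minval_eq:
  assumes "y \<in> argmin f"
  shows "minval f = f y"
  unfolding minval_def using assms
  by (intro Least_equality) (auto simp: argmin_def is_arg_min_linorder)

(* The argument v is the velocity of x. *)
definition energy ::
    "real \<Rightarrow> real \<Rightarrow> ('a::real_inner \<Rightarrow> real) \<Rightarrow> (real \<Rightarrow> 'a) \<Rightarrow> (real \<Rightarrow> 'a) \<Rightarrow> 'a \<Rightarrow> real \<Rightarrow> real \<Rightarrow> real" where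
  "energy \<alpha> \<beta> \<Phi> x v xstar l t =
     t * (t - \<beta> * (l + 2 - \<alpha>)) * (\<Phi> (x t) - minval \<Phi>)
     + 1 / 2 * (norm (l *\<^sub>R (x t - xstar) + t *\<^sub>R (v t + \<beta> *\<^sub>R gradient \<Phi> (x t))))\<^sup>2
     + l * (\<alpha> - l - 1) * (1 / 2) * (norm (x t - xstar))\<^sup>2"

end

(* For any l in [2, alpha - 1], the energy E = energy alpha beta Phi x x' xstar l satisfies
   E' <= (alpha - 2) beta / (t (t - beta)) E for t > max t0 beta: in the derivative the cross term
   <grad Phi(x), x'> cancels exactly, and convexity at xstar bounds the rest. Since
   beta / (t (t - beta)) = (ln ((t - beta) / t))', the function (t / (t - beta)) powr (alpha - 2) * E
   is nonincreasing, and E dominates t (t - beta) (Phi(x) - min Phi). For boundedness, the energy also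
   controls v = 2 (x - xstar) + t (x' + beta grad Phi(x)); pairing v with x - xstar bounds
   2 |x - xstar|^2 + t <x - xstar, x'> in terms of |v|, so that t^2 (|x - xstar|^2 - K) is
   nonincreasing. *)
theory Submission
  imports Defs
begin

section \<open>Riesz representation, gradients and the tangent inequality for convex
  functions\<close>

lemma riesz_representation:
  fixes f :: "'a::{real_inner, complete_space} \<Rightarrow> real"
  assumes f: "bounded_linear f"
  shows "\<exists>g. \<forall>h. f h = inner h g"
proof -
  interpret f: bounded_linear f by (fact f)
  \<comment> \<open>A minimizer of the energy functional \<open>J\<close> represents \<open>f\<close>.\<close>
  define J where "J y = inner y y - 2 * f y" for y
  obtain K where K: "\<And>y. norm (f y) \<le> norm y * K"
    using f.bounded by blast
  \<comment> \<open>Completing the square: \<open>J y\<close> is at least (|y| - K)^2 - K^2.\<close>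
  have J_ge: "J y \<ge> - K\<^sup>2" for y
  proof -
    have "f y \<le> norm y * K" using K[of y] by simp
    moreover have "0 \<le> (norm y - K)\<^sup>2" by simp
    ultimately show ?thesis
      unfolding J_def dot_square_norm by (simp add: power2_diff)
  qed
  define m where "m = Inf (range J)"
  have bdd: "bdd_below (range J)" using J_ge by (auto intro!: bdd_belowI[of _ "- K\<^sup>2"])
  have m_le: "m \<le> J y" for y
    unfolding m_def using bdd by (intro cInf_lower) auto
  have ex: "\<exists>y. J y < m + 1 / Suc n" for n
  proof -
    have "\<exists>z\<in>range J. z < m + 1 / Suc n"
      unfolding m_def by (subst cInf_less_iff [symmetric, OF _ bdd]) auto
    then show ?thesis by auto
  qed
  then obtain u where u: "\<And>n. J (u n) < m + 1 / Suc n" by metis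
  \<comment> \<open>The linear part of \<open>J\<close> cancels, so only the parallelogram law for
    the norm remains. Near-minimal values at \<open>a\<close> and \<open>b\<close> therefore force
    \<open>a\<close> and \<open>b\<close> to be close.\<close>
  have parallelogram: "J a + J b - 2 * J ((1/2) *\<^sub>R (a + b)) = (norm (a - b))\<^sup>2 / 2" for a b
    unfolding J_def power2_norm_eq_inner
    by (simp add: f.scaleR f.add inner_commute algebra_simps)
  have "Cauchy u"
  proof (rule metric_CauchyI)
    fix e :: real assume "e > 0"
    \<comment> \<open>Two terms beyond \<open>N\<close> have \<open>J\<close>-values summing to less
      than 2m + 2 / Suc N, and the midpoint value is at least m. Hence half the squared distance is
      below e^2 / 2.\<close>
    then obtain N where N: "1 / Suc N < e\<^sup>2 / 4"
      using nat_approx_posE[of "e\<^sup>2 / 4"] by auto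
    have "dist (u i) (u j) < e" if "N \<le> i" "N \<le> j" for i j
    proof -
      have "1 / Suc i \<le> 1 / Suc N" "1 / Suc j \<le> 1 / Suc N"
        using that by (auto intro!: divide_left_mono)
      then have "(norm (u i - u j))\<^sup>2 < e\<^sup>2"
        using parallelogram[of "u i" "u j"] m_le[of "(1/2) *\<^sub>R (u i + u j)"] u[of i] u[of j] N
        by linarith
      then show ?thesis
        using \<open>e > 0\<close> by (simp add: dist_norm power2_less_imp_less)
    qed
    then show "\<exists>M. \<forall>m\<ge>M. \<forall>n\<ge>M. dist (u m) (u n) < e" by blast
  qed
  then obtain g where g: "u \<longlonglongrightarrow> g" using Cauchy_convergent convergent_def by blast
  have "(\<lambda>n. J (u n)) \<longlonglongrightarrow> J g"
    unfolding J_def by (intro tendsto_intros f.tendsto g)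
  moreover have "(\<lambda>n. m + 1 / Suc n) \<longlonglongrightarrow> m + 0"
    by (intro tendsto_add tendsto_const LIMSEQ_Suc[OF lim_1_over_n])
  ultimately have "J g \<le> m"
    using u by (intro LIMSEQ_le[of "\<lambda>n. J (u n)"]) (auto simp: less_imp_le)
  then have g_min: "J g \<le> J y" for y using m_le[of y] by linarith
  have "f h = inner h g" for h
  proof -
    \<comment> \<open>First variation of \<open>J\<close> at its minimizer \<open>g\<close> in the
      direction \<open>h\<close>.\<close>
    have deriv: "((\<lambda>t. J (g + t *\<^sub>R h)) has_real_derivative 2 * (inner h g - f h)) (at 0)"
      unfolding J_def f.add f.scaleR
      by (auto intro!: derivative_eq_intros simp: has_field_derivative_def inner_commute algebra_simps fun_eq_iff)
    have "2 * (inner h g - f h) = 0"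
      using g_min by (intro DERIV_local_min[OF deriv zero_less_one]) simp
    then show ?thesis by simp
  qed
  then show ?thesis by blast
qed

text \<open>Identifies the dual with the space. Being bounded and linear, it carries
  differentiability of a dual-valued derivative over to the gradient.\<close>

definition riesz :: "('a::{real_inner, complete_space} \<Rightarrow>\<^sub>L real) \<Rightarrow> 'a" where
  "riesz f = (SOME g. \<forall>h. blinfun_apply f h = inner h g)"

lemma inner_riesz: "inner h (riesz f) = blinfun_apply f h"
proof -
  have "\<forall>h. blinfun_apply f h = inner h (riesz f)"
    unfolding riesz_def by (rule someI_ex[OF riesz_representation[OF blinfun.bounded_linear_right]])
  then show ?thesis by simp
qed

lemma riesz_eqI: "(\<And>h. inner h g = blinfun_apply f h) \<Longrightarrow> riesz f = g"
  using vector_eq_ldot[of "riesz f" g] by (simp add: inner_riesz)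

lemma bounded_linear_riesz: "bounded_linear riesz"
proof (rule bounded_linear_intro[where K = 1])
  fix f :: "'a \<Rightarrow>\<^sub>L real"
  show "norm (riesz f) \<le> norm f * 1"
  proof (cases "riesz f = 0")
    case False
    have "norm (riesz f) * norm (riesz f) = blinfun_apply f (riesz f)"
      by (simp add: inner_riesz[symmetric] dot_square_norm power2_eq_square)
    also have "\<dots> \<le> norm f * norm (riesz f)"
      using norm_blinfun[of f "riesz f"] by simp
    finally show ?thesis using False by simp
  qed simp
qed (auto intro!: riesz_eqI simp: inner_riesz inner_add_right plus_blinfun.rep_eq scaleR_blinfun.rep_eq)

text \<open>The gradient is \<open>riesz\<close> composed with the Frechet derivative, so the chain
  rule makes it differentiable. This certifies that \<open>gradient\<close> and
  \<open>hessian\<close>, defined through choice operators, are genuine derivatives here.\<close>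

lemma twice_continuously_differentiable_gradient:
  fixes f :: "'a::{real_inner, complete_space} \<Rightarrow> real"
  assumes "twice_continuously_differentiable f"
  shows "GDERIV f y :> gradient f y"
    and "(gradient f has_derivative hessian f y) (at y)"
proof -
  obtain D :: "'a \<Rightarrow> 'a \<Rightarrow>\<^sub>L real" and D2
    where D: "\<And>y. (f has_derivative blinfun_apply (D y)) (at y)"
      and D2: "\<And>y. (D has_derivative blinfun_apply (D2 y)) (at y)"
    using assms unfolding twice_continuously_differentiable_def by blast
  have G: "GDERIV f y :> riesz (D y)" for y
    unfolding gderiv_def inner_riesz using D by (simp add: eta_contract_eq)
  then have grad: "gradient f = (\<lambda>y. riesz (D y))"
    by (simp add: gradient_eqI fun_eq_iff)
  show "GDERIV f y :> gradient f y"
    using G by (simp add: grad)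
  have *: "(gradient f has_derivative (\<lambda>h. riesz (D2 y h))) (at y)"
    unfolding grad by (rule bounded_linear.has_derivative[OF bounded_linear_riesz D2])
  then show "(gradient f has_derivative hessian f y) (at y)"
    by (simp add: hessian_eqI)
qed

text \<open>Restricted to the line through \<open>y\<close> and \<open>z\<close>, the function is
  convex in one real variable and lies above its tangent at parameter 0.\<close>

lemma convex_on_ge_gradient:
  fixes f :: "'a::real_inner \<Rightarrow> real"
  assumes conv: "convex_on UNIV f" and g: "GDERIV f y :> g"
  shows "f y + inner (z - y) g \<le> f z"
proof -
  define p where "p s = y + s *\<^sub>R (z - y)" for s :: real
  have "convex_on UNIV (\<lambda>s. f (p s))"
  proof (rule convex_onI)
    fix t a b :: real assume "0 < t" "t < 1"
    moreover have "p ((1 - t) *\<^sub>R a + t *\<^sub>R b) = (1 - t) *\<^sub>R p a + t *\<^sub>R p b"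
      by (simp add: p_def algebra_simps)
    ultimately show "f (p ((1 - t) *\<^sub>R a + t *\<^sub>R b)) \<le> (1 - t) * f (p a) + t * f (p b)"
      using convex_onD[OF conv, of t "p a" "p b"] by simp
  qed simp
  moreover have "((\<lambda>s. f (p s)) has_real_derivative inner (z - y) g) (at 0)"
  proof -
    have "(p has_derivative (\<lambda>s. s *\<^sub>R (z - y))) (at 0)"
      unfolding p_def by (auto intro!: derivative_eq_intros)
    moreover have "(f has_derivative (\<lambda>h. inner h g)) (at (p 0))"
      using g by (simp add: gderiv_def p_def)
    ultimately have "((\<lambda>s. f (p s)) has_derivative (\<lambda>s. inner (s *\<^sub>R (z - y)) g)) (at 0)"
      by (rule has_derivative_compose)
    then show ?thesis by (simp add: has_field_derivative_def mult_commute_abs)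
  qed
  ultimately have "f (p 1) - f (p 0) \<ge> inner (z - y) g * (1 - 0)"
    by (intro convex_on_imp_above_tangent[where A = UNIV]) auto
  then show ?thesis by (simp add: p_def)
qed


section \<open>Derivatives along a trajectory of the inertial system\<close>

lemma has_real_derivative_norm_squared:
  fixes f :: "real \<Rightarrow> 'a::real_inner"
  assumes "(f has_vector_derivative f') (at t within S)"
  shows "((\<lambda>t. (norm (f t))\<^sup>2) has_real_derivative 2 * inner (f t) f') (at t within S)"
proof -
  have "((\<lambda>t. inner (f t) (f t)) has_derivative
      (\<lambda>h. inner (f t) (h *\<^sub>R f') + inner (h *\<^sub>R f') (f t))) (at t within S)"
    using assms unfolding has_vector_derivative_def by (intro has_derivative_inner)
  also have "(\<lambda>h. inner (f t) (h *\<^sub>R f') + inner (h *\<^sub>R f') (f t)) = (*) (2 * inner (f t) f')"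
    by (simp add: fun_eq_iff inner_commute)
  finally show ?thesis
    by (simp add: power2_norm_eq_inner has_field_derivative_def)
qed

text \<open>One minimizer is fixed together with the trajectory, since the energy depends on it. At
  \<open>t0\<close> the derivatives are one-sided, so the differential estimates below are made at
  times \<open>t > t0\<close>.\<close>

locale inertial_system =
  fixes \<Phi> :: "'a::{real_inner, complete_space} \<Rightarrow> real"
    and x x' x'' :: "real \<Rightarrow> 'a"
    and \<alpha> \<beta> t0 :: real
    and xstar :: 'a
  assumes alpha_ge: "\<alpha> \<ge> 3" and beta_pos: "\<beta> > 0" and t0_pos: "t0 > 0"
    and smooth: "twice_continuously_differentiable \<Phi>"
    and convex: "convex_on UNIV \<Phi>"
    and minimizer: "xstar \<in> argmin \<Phi>"
    and x_deriv: "\<And>t. t \<ge> t0 \<Longrightarrow> (x has_vector_derivative x' t) (at t within {t0..})"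
    and x'_deriv: "\<And>t. t \<ge> t0 \<Longrightarrow> (x' has_vector_derivative x'' t) (at t within {t0..})"
    and ode: "\<And>t. t \<ge> t0 \<Longrightarrow>
           x'' t + (\<alpha> / t) *\<^sub>R x' t + \<beta> *\<^sub>R hessian \<Phi> (x t) (x' t) + gradient \<Phi> (x t) = 0"
begin

abbreviation "gap t \<equiv> \<Phi> (x t) - minval \<Phi>"
abbreviation "grad t \<equiv> gradient \<Phi> (x t)"
abbreviation "E \<equiv> energy \<alpha> \<beta> \<Phi> x x' xstar"

lemma gap_nonneg: "gap t \<ge> 0"
  using minimizer by (auto simp: minval_eq argmin_def is_arg_min_linorder)

text \<open>The tangent inequality at \<open>x t\<close>, evaluated at \<open>xstar\<close>.
  Convexity enters the estimates along the trajectory only through this bound.\<close>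

lemma gap_le_inner: "gap t \<le> inner (grad t) (x t - xstar)"
  using convex_on_ge_gradient[OF convex twice_continuously_differentiable_gradient(1)[OF smooth],
      of "x t" xstar]
  by (simp add: minval_eq[OF minimizer] inner_diff_left inner_diff_right inner_commute)

lemma
  assumes "t > t0"
  shows x_deriv_at: "(x has_vector_derivative x' t) (at t)"
    and x'_deriv_at: "(x' has_vector_derivative x'' t) (at t)"
proof -
  have "at t within {t0..} = at t"
    using assms by (intro at_within_interior) simp
  then show "(x has_vector_derivative x' t) (at t)" "(x' has_vector_derivative x'' t) (at t)"
    using x_deriv[of t] x'_deriv[of t] assms by auto
qed

lemma gap_deriv:
  assumes "t > t0"
  shows "(gap has_real_derivative inner (x' t) (grad t)) (at t)"
proof -
  have "((\<lambda>t. \<Phi> (x t)) has_derivative (\<lambda>h. inner (h *\<^sub>R x' t) (grad t))) (at t)"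
    using x_deriv_at[OF assms] twice_continuously_differentiable_gradient(1)[OF smooth, of "x t"]
    unfolding has_vector_derivative_def gderiv_def by (rule has_derivative_compose)
  then have "((\<lambda>t. \<Phi> (x t)) has_real_derivative inner (x' t) (grad t)) (at t)"
    by (simp add: has_field_derivative_def mult_commute_abs)
  from DERIV_diff[OF this DERIV_const] show ?thesis by simp
qed

lemma grad_deriv:
  assumes "t > t0"
  shows "(grad has_vector_derivative hessian \<Phi> (x t) (x' t)) (at t)"
proof -
  have H: "(gradient \<Phi> has_derivative hessian \<Phi> (x t)) (at (x t))"
    by (rule twice_continuously_differentiable_gradient(2)[OF smooth])
  have "(grad has_derivative (\<lambda>h. hessian \<Phi> (x t) (h *\<^sub>R x' t))) (at t)"
    using x_deriv_at[OF assms] H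
    unfolding has_vector_derivative_def by (rule has_derivative_compose)
  then show ?thesis
    using has_derivative_linear[OF H] by (simp add: has_vector_derivative_def linear_cmul)
qed

text \<open>The derivative of \<open>x' + \<beta> grad\<close> is exactly the combination of
  acceleration and Hessian term that the equation expresses through \<open>x'\<close> and
  \<open>grad\<close>. Hence no second-order term survives in the derivative of the energy.\<close>

lemma momentum_deriv:
  assumes "t > t0"
  shows "((\<lambda>t. l *\<^sub>R (x t - xstar) + t *\<^sub>R (x' t + \<beta> *\<^sub>R grad t)) has_vector_derivative
           (l + 1 - \<alpha>) *\<^sub>R x' t + (\<beta> - t) *\<^sub>R grad t) (at t)"
proof -
  let ?h = "hessian \<Phi> (x t) (x' t)"
  have acc: "x'' t + \<beta> *\<^sub>R ?h = - (\<alpha> / t) *\<^sub>R x' t - grad t"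
    using ode[of t] assms by (subst eq_iff_diff_eq_0) (simp add: algebra_simps)
  have *: "t *\<^sub>R (x'' t + \<beta> *\<^sub>R ?h) = - \<alpha> *\<^sub>R x' t - t *\<^sub>R grad t"
    unfolding acc using assms t0_pos by (simp add: scaleR_diff_right)
  have "((\<lambda>t. l *\<^sub>R (x t - xstar) + t *\<^sub>R (x' t + \<beta> *\<^sub>R grad t)) has_vector_derivative
           l *\<^sub>R x' t + (t *\<^sub>R (x'' t + \<beta> *\<^sub>R ?h) + (x' t + \<beta> *\<^sub>R grad t))) (at t)"
    by (auto intro!: derivative_eq_intros x_deriv_at x'_deriv_at grad_deriv assms)
  then show ?thesis
    unfolding * by (simp add: algebra_simps)
qed

text \<open>The weights in \<open>energy\<close> produce two cancellations. The factor t (t -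
  \<beta> (l + 2 - \<alpha>)) removes the products of \<open>x'\<close> with the gradient, and l
  (\<alpha> - l - 1) removes those of \<open>x'\<close> with \<open>x t - xstar\<close>. This is an
  exact identity for every real \<open>l\<close>.\<close>

lemma energy_deriv:
  assumes "t > t0"
  shows "(E l has_real_derivative
           (2 * t - \<beta> * (l + 2 - \<alpha>)) * gap t - l * (t - \<beta>) * inner (grad t) (x t - xstar)
           - (\<alpha> - l - 1) * t * (norm (x' t))\<^sup>2 - t * \<beta> * (t - \<beta>) * (norm (grad t))\<^sup>2) (at t)"
proof -
  define v where "v t = l *\<^sub>R (x t - xstar) + t *\<^sub>R (x' t + \<beta> *\<^sub>R grad t)" for t
  have v: "((\<lambda>t. (norm (v t))\<^sup>2) has_real_derivative
      2 * inner (v t) ((l + 1 - \<alpha>) *\<^sub>R x' t + (\<beta> - t) *\<^sub>R grad t)) (at t)"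
    unfolding v_def by (intro has_real_derivative_norm_squared momentum_deriv assms)
  have d: "((\<lambda>t. (norm (x t - xstar))\<^sup>2) has_real_derivative 2 * inner (x t - xstar) (x' t)) (at t)"
    by (intro has_real_derivative_norm_squared)
      (auto intro!: derivative_eq_intros x_deriv_at assms)
  have q: "((\<lambda>t. t * (t - \<beta> * (l + 2 - \<alpha>))) has_real_derivative
      2 * t - \<beta> * (l + 2 - \<alpha>)) (at t)"
    by (auto intro!: derivative_eq_intros)
  have "((\<lambda>t. t * (t - \<beta> * (l + 2 - \<alpha>)) * gap t + 1 / 2 * (norm (v t))\<^sup>2
           + l * (\<alpha> - l - 1) * (1 / 2) * (norm (x t - xstar))\<^sup>2) has_real_derivative
         (2 * t - \<beta> * (l + 2 - \<alpha>)) * gap t + t * (t - \<beta> * (l + 2 - \<alpha>)) * inner (x' t) (grad t)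
         + inner (v t) ((l + 1 - \<alpha>) *\<^sub>R x' t + (\<beta> - t) *\<^sub>R grad t)
         + l * (\<alpha> - l - 1) * inner (x t - xstar) (x' t)) (at t)"
    by (rule DERIV_cong[OF DERIV_add[OF DERIV_add[OF DERIV_mult[OF q gap_deriv[OF assms]]
            DERIV_cmult[OF v]] DERIV_cmult[OF d]]]) simp
  also have "(2 * t - \<beta> * (l + 2 - \<alpha>)) * gap t + t * (t - \<beta> * (l + 2 - \<alpha>)) * inner (x' t) (grad t)
         + inner (v t) ((l + 1 - \<alpha>) *\<^sub>R x' t + (\<beta> - t) *\<^sub>R grad t)
         + l * (\<alpha> - l - 1) * inner (x t - xstar) (x' t) =
      (2 * t - \<beta> * (l + 2 - \<alpha>)) * gap t - l * (t - \<beta>) * inner (grad t) (x t - xstar)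
           - (\<alpha> - l - 1) * t * (norm (x' t))\<^sup>2 - t * \<beta> * (t - \<beta>) * (norm (grad t))\<^sup>2"
    unfolding v_def power2_norm_eq_inner
      inner_add_left inner_add_right inner_scaleR_left inner_scaleR_right
      inner_commute[of "grad t" "x t - xstar"] inner_commute[of "grad t" "x' t"]
    by (simp add: algebra_simps)
  finally show ?thesis
    unfolding v_def energy_def .
qed

section \<open>Lower bounds for the energy and decay of the gap\<close>

lemma energy_ge_momentum:
  assumes l: "l \<in> {2..\<alpha> - 1}" and t: "t > 0"
  shows "t * (t - \<beta>) * gap t + 1 / 2 * (norm (l *\<^sub>R (x t - xstar) + t *\<^sub>R (x' t + \<beta> *\<^sub>R grad t)))\<^sup>2
    \<le> E l t"
proof -
  \<comment> \<open>The upper bound l \<le> \<alpha> - 1 makes the weight of the gap at least t (t -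
    \<beta>), whatever \<open>l\<close> is.\<close>
  have "\<beta> * (l + 2 - \<alpha>) \<le> \<beta> * 1"
    using l beta_pos by (intro mult_left_mono) auto
  then have "t * (t - \<beta>) * gap t \<le> t * (t - \<beta> * (l + 2 - \<alpha>)) * gap t"
    using t gap_nonneg[of t] by (intro mult_right_mono mult_left_mono) auto
  moreover have "0 \<le> l * (\<alpha> - l - 1) * (1 / 2) * (norm (x t - xstar))\<^sup>2"
    using l by auto
  ultimately show ?thesis
    unfolding energy_def by linarith
qed

lemma energy_ge:
  assumes "l \<in> {2..\<alpha> - 1}" and "t > 0"
  shows "t * (t - \<beta>) * gap t \<le> E l t"
  using energy_ge_momentum[OF assms] by (rule order_trans[rotated]) simp

lemma energy_deriv_le:
  assumes "t > max t0 \<beta>" and l: "l \<in> {2..\<alpha> - 1}"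
  obtains D where "(E l has_real_derivative D) (at t)"
    and "D \<le> (\<alpha> - 2) * \<beta> / (t * (t - \<beta>)) * E l t"
proof
  have t: "t > t0" "t > \<beta>" "t > 0" using assms t0_pos by auto
  let ?D = "(2 * t - \<beta> * (l + 2 - \<alpha>)) * gap t - l * (t - \<beta>) * inner (grad t) (x t - xstar)
           - (\<alpha> - l - 1) * t * (norm (x' t))\<^sup>2 - t * \<beta> * (t - \<beta>) * (norm (grad t))\<^sup>2"
  show "(E l has_real_derivative ?D) (at t)"
    by (rule energy_deriv[OF t(1)])
  have "l * (t - \<beta>) * gap t \<le> l * (t - \<beta>) * inner (grad t) (x t - xstar)"
    using l t gap_le_inner by (intro mult_left_mono) auto
  moreover have "0 \<le> (\<alpha> - l - 1) * t * (norm (x' t))\<^sup>2" "0 \<le> t * \<beta> * (t - \<beta>) * (norm (grad t))\<^sup>2"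
    using l t beta_pos by auto
  \<comment> \<open>After the convexity bound, the terms in l \<beta> cancel. The part growing with
    \<open>t\<close> has coefficient 2 - l, which is nonpositive, so only a constant multiple of the
    gap is left.\<close>
  moreover have "(2 * t - \<beta> * (l + 2 - \<alpha>)) * gap t - l * (t - \<beta>) * gap t
      = (\<alpha> - 2) * \<beta> * gap t - (l - 2) * (t * gap t)"
    by (simp add: algebra_simps)
  moreover have "0 \<le> (l - 2) * (t * gap t)"
    using l t gap_nonneg[of t] by auto
  ultimately have "?D \<le> (\<alpha> - 2) * \<beta> * gap t"
    by linarith
  moreover have "gap t \<le> E l t / (t * (t - \<beta>))"
    using energy_ge[OF l \<open>t > 0\<close>] t by (simp add: field_simps)
  then have "(\<alpha> - 2) * \<beta> * gap t \<le> (\<alpha> - 2) * \<beta> * (E l t / (t * (t - \<beta>)))"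
    using alpha_ge beta_pos by (intro mult_left_mono) auto
  ultimately show "?D \<le> (\<alpha> - 2) * \<beta> / (t * (t - \<beta>)) * E l t"
    by simp
qed

lemma energy_decay:
  assumes "max t0 \<beta> < s" "s \<le> t" and l: "l \<in> {2..\<alpha> - 1}"
  shows "(t / (t - \<beta>)) powr (\<alpha> - 2) * E l t \<le> (s / (s - \<beta>)) powr (\<alpha> - 2) * E l s"
proof -
  \<comment> \<open>Integrating factor for the inequality of \<open>energy_deriv_le\<close>. The
    logarithmic form makes it easy to differentiate; it agrees with the power in the statement for r
    > \<beta>.\<close>
  define w where "w r = exp ((\<alpha> - 2) * (ln r - ln (r - \<beta>)))" for r
  have "w t * E l t \<le> w s * E l s"
  proof (rule DERIV_nonpos_imp_nonincreasing[OF \<open>s \<le> t\<close>])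
    fix r assume "s \<le> r" "r \<le> t"
    with assms have r: "r > max t0 \<beta>" "r > 0" "r > \<beta>" using t0_pos by auto
    obtain D where D: "(E l has_real_derivative D) (at r)"
      and le: "D \<le> (\<alpha> - 2) * \<beta> / (r * (r - \<beta>)) * E l r"
      using energy_deriv_le[OF r(1) l] .
    have "(w has_real_derivative w r * ((\<alpha> - 2) * (1 / r - 1 / (r - \<beta>)))) (at r)"
      unfolding w_def using r by (auto intro!: derivative_eq_intros)
    from DERIV_mult[OF this D]
    have "((\<lambda>r. w r * E l r) has_real_derivative
        w r * (D + (\<alpha> - 2) * (1 / r - 1 / (r - \<beta>)) * E l r)) (at r)"
      by (simp add: algebra_simps)
    moreover have "1 / r - 1 / (r - \<beta>) = - \<beta> / (r * (r - \<beta>))"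
      using r by (simp add: field_simps)
    then have "D + (\<alpha> - 2) * (1 / r - 1 / (r - \<beta>)) * E l r \<le> 0"
      using le by simp
    moreover have "w r \<ge> 0" by (simp add: w_def)
    ultimately show "\<exists>y. ((\<lambda>r. w r * E l r) has_real_derivative y) (at r) \<and> y \<le> 0"
      by (meson mult_nonneg_nonpos)
  qed
  moreover have "w r = (r / (r - \<beta>)) powr (\<alpha> - 2)" if "r \<ge> s" for r
    using that assms t0_pos by (simp add: w_def powr_def ln_div)
  ultimately show ?thesis using \<open>s \<le> t\<close> by simp
qed

lemma gap_le:
  assumes "max t0 \<beta> < s" "s \<le> t" and l: "l \<in> {2..\<alpha> - 1}"
  shows "gap t \<le> 1 / t\<^sup>2 * (s / (s - \<beta>)) powr (\<alpha> - 2) * E l s"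
proof -
  have t: "t > \<beta>" "t > 0" using assms t0_pos by auto
  have "t\<^sup>2 * gap t = t / (t - \<beta>) * (t * (t - \<beta>) * gap t)"
    using t by (simp add: power2_eq_square)
  also have "\<dots> \<le> t / (t - \<beta>) * E l t"
    using t by (intro mult_left_mono energy_ge l) auto
  \<comment> \<open>The factor that turns t (t - \<beta>) into t^2 is absorbed by the decay weight:
    its base exceeds 1 and the exponent \<alpha> - 2 is at least 1.\<close>
  also have "\<dots> \<le> (t / (t - \<beta>)) powr (\<alpha> - 2) * E l t"
  proof (rule mult_right_mono)
    have "(t / (t - \<beta>)) powr 1 \<le> (t / (t - \<beta>)) powr (\<alpha> - 2)"
      using t beta_pos alpha_ge by (intro powr_mono) auto
    then show "t / (t - \<beta>) \<le> (t / (t - \<beta>)) powr (\<alpha> - 2)"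
      using t by simp
    show "0 \<le> E l t"
      using t gap_nonneg[of t] by (intro order_trans[OF _ energy_ge[OF l]]) auto
  qed
  also have "\<dots> \<le> (s / (s - \<beta>)) powr (\<alpha> - 2) * E l s"
    by (rule energy_decay[OF assms])
  finally show ?thesis
    using t by (simp add: field_simps)
qed

section \<open>Boundedness of the trajectory\<close>

lemma x_bounded: "bounded (x ` {t0..})"
proof -
  define s where "s = max t0 \<beta> + 1"
  define d where "d t = x t - xstar" for t
  \<comment> \<open>By \<open>energy_decay\<close>, whose weight at later times is at least 1, this
    bounds \<open>E 2 t\<close> for all t \<ge> s. The value 2 is admissible because \<alpha> \<ge>
    3.\<close>
  define K where "K = (s / (s - \<beta>)) powr (\<alpha> - 2) * E 2 s"
  have s: "max t0 \<beta> < s" by (simp add: s_def)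
  have two: "2 \<in> {2..\<alpha> - 1}" using alpha_ge by simp
  \<comment> \<open>With y = |d|^2 - K, the derivative of t^2 y is 2t (y + t y' / 2), and y + t y' /
    2 is the quantity the energy controls.\<close>
  have deriv: "((\<lambda>t. t\<^sup>2 * ((norm (d t))\<^sup>2 - K)) has_real_derivative
      2 * t * ((norm (d t))\<^sup>2 - K) + t\<^sup>2 * (2 * inner (d t) (x' t))) (at t)" if "t > t0" for t
  proof -
    have "(d has_vector_derivative x' t) (at t)"
      unfolding d_def by (auto intro!: derivative_eq_intros x_deriv_at that)
    from DERIV_diff[OF has_real_derivative_norm_squared[OF this] DERIV_const[of K]]
    have "((\<lambda>t. (norm (d t))\<^sup>2 - K) has_real_derivative 2 * inner (d t) (x' t)) (at t)"
      by simp
    from DERIV_mult[OF DERIV_power[OF DERIV_ident, of 2] this] show ?thesis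
      by (simp add: algebra_simps)
  qed
  have nonpos: "2 * t * ((norm (d t))\<^sup>2 - K) + t\<^sup>2 * (2 * inner (d t) (x' t)) \<le> 0" if "t \<ge> s" for t
  proof -
    have t: "t > \<beta>" "t > 0" using that s t0_pos by auto
    define v where "v = 2 *\<^sub>R d t + t *\<^sub>R (x' t + \<beta> *\<^sub>R grad t)"
    have gap: "0 \<le> t * (t - \<beta>) * gap t" using t gap_nonneg[of t] by simp
    have "1 \<le> (t / (t - \<beta>)) powr (\<alpha> - 2)"
      using t beta_pos alpha_ge by (intro ge_one_powr_ge_zero) auto
    then have "E 2 t \<le> (t / (t - \<beta>)) powr (\<alpha> - 2) * E 2 t"
      using energy_ge[OF two, of t] t gap by (simp add: mult_le_cancel_right1)
    also have "\<dots> \<le> K"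
      unfolding K_def by (rule energy_decay[OF s that two])
    finally have "(norm v)\<^sup>2 \<le> 2 * K"
      using energy_ge_momentum[OF two, of t] t gap unfolding v_def d_def by simp
    \<comment> \<open>The factor 2 in Young's inequality is chosen so that one of the two copies of
      |d|^2 in the pairing of \<open>d\<close> with \<open>v\<close> is left over.\<close>
    have "0 \<le> (norm (2 *\<^sub>R d t - v))\<^sup>2" by simp
    then have "inner (d t) v \<le> (norm (d t))\<^sup>2 + (norm v)\<^sup>2 / 4"
      unfolding power2_norm_eq_inner
      by (simp add: inner_diff_left inner_diff_right inner_commute)
    moreover have "inner (d t) v = 2 * (norm (d t))\<^sup>2 + t * inner (d t) (x' t) + t * \<beta> * inner (grad t) (d t)"
      unfolding v_def power2_norm_eq_inner by (simp add: inner_add_right inner_commute algebra_simps)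
    moreover have "0 \<le> t * \<beta> * inner (grad t) (d t)"
      using t beta_pos gap_le_inner[of t] gap_nonneg[of t] unfolding d_def
      by (intro mult_nonneg_nonneg) auto
    \<comment> \<open>The estimate gives the bound |v|^2 / 4 \<le> K / 2. This is at most
      \<open>K\<close>, which is nonnegative because |v|^2 \<le> 2K.\<close>
    ultimately have "(norm (d t))\<^sup>2 - K + t * inner (d t) (x' t) \<le> 0"
      using \<open>(norm v)\<^sup>2 \<le> 2 * K\<close> zero_le_power2[of "norm v"] by linarith
    then have "2 * t * ((norm (d t))\<^sup>2 - K + t * inner (d t) (x' t)) \<le> 0"
      using t by (intro mult_nonneg_nonpos) auto
    then show ?thesis by (simp add: algebra_simps power2_eq_square)
  qed
  \<comment> \<open>The sign of |d s|^2 - K is unknown; with the absolute value, s^2 may be enlarged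
    to t^2 and then divided out.\<close>
  have bound: "(norm (d t))\<^sup>2 \<le> K + \<bar>(norm (d s))\<^sup>2 - K\<bar>" if "t \<ge> s" for t
  proof -
    have "t\<^sup>2 * ((norm (d t))\<^sup>2 - K) \<le> s\<^sup>2 * ((norm (d s))\<^sup>2 - K)"
      using that
    proof (rule DERIV_nonpos_imp_nonincreasing)
      fix r assume "s \<le> r" "r \<le> t"
      then show "\<exists>y. ((\<lambda>t. t\<^sup>2 * ((norm (d t))\<^sup>2 - K)) has_real_derivative y) (at r) \<and> y \<le> 0"
        using deriv[of r] nonpos[of r] s by (intro exI conjI) auto
    qed
    also have "\<dots> \<le> s\<^sup>2 * \<bar>(norm (d s))\<^sup>2 - K\<bar>"
      by (intro mult_left_mono) auto
    also have "\<dots> \<le> t\<^sup>2 * \<bar>(norm (d s))\<^sup>2 - K\<bar>"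
      using that s t0_pos by (intro mult_right_mono power_mono) auto
    finally show ?thesis
      using that s t0_pos by simp
  qed
  have "bounded (x ` {s..})"
  proof (rule boundedI)
    fix y assume "y \<in> x ` {s..}"
    then obtain t where t: "t \<ge> s" "y = d t + xstar" by (auto simp: d_def)
    have "norm (d t) \<le> sqrt (K + \<bar>(norm (d s))\<^sup>2 - K\<bar>)"
      using bound[OF t(1)] by (intro real_le_rsqrt)
    then show "norm y \<le> sqrt (K + \<bar>(norm (d s))\<^sup>2 - K\<bar>) + norm xstar"
      unfolding t(2) by (intro norm_triangle_mono) auto
  qed
  \<comment> \<open>The energy argument only covers times from \<open>s\<close> on; the initial
    segment is handled by compactness.\<close>
  moreover have "continuous_on {t0..s} x"
  proof (rule continuous_on_subset)
    show "continuous_on {t0..} x"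
      by (rule continuous_on_vector_derivative) (use x_deriv in auto)
  qed auto
  then have "bounded (x ` {t0..s})"
    by (intro compact_imp_bounded compact_continuous_image) auto
  moreover have "{t0..} = {t0..s} \<union> {s..}" using s by auto
  ultimately show ?thesis by (simp add: image_Un)
qed

section \<open>The rate of convergence and the final statement\<close>

lemma gap_bigo: "gap \<in> O[at_top](\<lambda>t. 1 / t\<^sup>2)"
proof -
  define s where "s = max t0 \<beta> + 1"
  have *: "2 \<in> {2..\<alpha> - 1}" "max t0 \<beta> < s" using alpha_ge by (auto simp: s_def)
  have "norm (gap t) \<le> (s / (s - \<beta>)) powr (\<alpha> - 2) * E 2 s * norm (1 / t\<^sup>2)" if "t \<ge> s" for t
    using gap_le[OF *(2) that *(1)] gap_nonneg[of t] by (simp add: mult_ac)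
  then show ?thesis
    by (intro bigoI eventually_mono[OF eventually_ge_at_top[of s]])
qed

end

theorem theorem1p10:
  fixes \<Phi> :: "'a::{real_inner, complete_space} \<Rightarrow> real"
    and x x' x'' :: "real \<Rightarrow> 'a"
    and \<alpha> \<beta> t0 :: real
  assumes "\<alpha> \<ge> 3" and "\<beta> > 0" and "t0 > 0"
    and "twice_continuously_differentiable \<Phi>"
    and "convex_on UNIV \<Phi>"
    and "argmin \<Phi> \<noteq> {}"
    and "\<And>t. t \<ge> t0 \<Longrightarrow> (x has_vector_derivative x' t) (at t within {t0..})"
    and "\<And>t. t \<ge> t0 \<Longrightarrow> (x' has_vector_derivative x'' t) (at t within {t0..})"
    and "continuous_on {t0..} x''"
    and "\<And>t. t \<ge> t0 \<Longrightarrow>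
           x'' t + (\<alpha> / t) *\<^sub>R x' t + \<beta> *\<^sub>R hessian \<Phi> (x t) (x' t) + gradient \<Phi> (x t) = 0"
  shows "bounded (x ` {t0..}) \<and>
    (\<forall>xstar\<in>argmin \<Phi>. \<forall>l\<in>{2..\<alpha> - 1}. \<forall>s t. max t0 \<beta> < s \<and> s \<le> t \<longrightarrow>
       \<Phi> (x t) - minval \<Phi> \<le>
         1 / t\<^sup>2 * (s / (s - \<beta>)) powr (\<alpha> - 2) * energy \<alpha> \<beta> \<Phi> x x' xstar l s) \<and>
    (\<lambda>t. \<Phi> (x t) - minval \<Phi>) \<in> O[at_top](\<lambda>t. 1 / t\<^sup>2)"
proof -
  have sys: "inertial_system \<Phi> x x' x'' \<alpha> \<beta> t0 xstar" if "xstar \<in> argmin \<Phi>" for xstar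
    using assms that by unfold_locales auto
  \<comment> \<open>Boundedness and the rate do not mention a minimizer, so one witness suffices for
    them; the explicit estimate is instantiated at every minimizer.\<close>
  obtain z where "z \<in> argmin \<Phi>" using assms(6) by blast
  note z = sys[OF this]
  show ?thesis
    using inertial_system.x_bounded[OF z] inertial_system.gap_bigo[OF z]
      inertial_system.gap_le[OF sys] by blast
qed

end
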